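(* Let $\Omega\subset\mathbb{R}^N$ be an unbounded domain satisfying the cone condition and let $s\in(0,1)$. Let $p:\overline{\Omega}\times\overline{\Omega}\to(1,+\infty)$ be a uniformly continuous function such that $$1<p^-=\inf_{(x,y)\in\overline\Omega\times\overline\Omega}p(x,y)\le p(x,y)\le p^+=\sup_{(x,y)\in\overline\Omega\times\overline\Omega}p(x,y)<+\infty,\qquad p(x,y)=p(y,x)\ \text{ for all }(x,y)\in\overline\Omega\times\overline\Omega,$$ and $sp^+<N$. Write $\overline p(x)=p(x,x)$ and $p_s^*(x)=\frac{N\overline p(x)}{N-s\overline p(x)}$ for $x\in\overline\Omega$. Let $q:\overline\Omega\to(1,+\infty)$ be a uniformly continuous function such that $$\overline p(x)\le q(x)\ \text{ for all }x\in\overline\Omega\qquad\text{and}\qquad \inf_{x\in\overline\Omega}\bigl(p_s^*(x)-q(x)\bigr)>0.$$ Then $W^{s,p(x,y)}(\Omega)$ is continuously embedded in $L^{q(x)}(\Omega)$; that is, $W^{s,p(x,y)}(\Omega)\subset L^{q(x)}(\Omega)$ and there is a constant $C>0$ such that $\|u\|_{L^{q(x)}(\Omega)}\le C\|u\|_W$ for all $u\in W^{s,p(x,y)}(\Omega)$.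
   Context: Cone condition: an open set $\Omega\subset\mathbb{R}^N$ satisfies the cone condition if there exists a finite cone $O$ such that each $x\in\Omega$ is the vertex of a finite cone $O_x$ contained in $\Omega$ and congruent to $O$ (i.e. obtained from $O$ by a rigid motion, not necessarily by a parallel translation). Variable exponent Lebesgue space: for a continuous $q:\overline\Omega\to(1,+\infty)$, $L^{q(x)}(\Omega)$ is the set of measurable $u:\Omega\to\mathbb{R}$ with $\int_\Omega|u(x)|^{q(x)}dx<+\infty$, with the Luxemburg norm $\|u\|_{L^{q(x)}(\Omega)}=\inf\{\lambda>0:\int_\Omega|u(x)/\lambda|^{q(x)}dx\le1\}$. Fractional Sobolev space with variable exponent: $$W=W^{s,p(x,y)}(\Omega)=\Bigl\{u\in L^{\overline p(x)}(\Omega):\int_{\Omega\times\Omega}\frac{|u(x)-u(y)|^{p(x,y)}}{\lambda^{p(x,y)}|x-y|^{N+sp(x,y)}}\,dx\,dy<\infty\text{ for some }\lambda>0\Bigr\},$$ with norm $\|u\|_W=\|u\|_{L^{\overline p(x)}(\Omega)}+[u]_{s,p(x,y)}$, where $$[u]_{s,p(x,y)}=\inf\Bigl\{\lambda>0:\int_\Omega\int_\Omega\frac{|u(x)-u(y)|^{p(x,y)}}{\lambda^{p(x,y)}|x-y|^{N+sp(x,y)}}\,dx\,dy<1\Bigr\}.$$ *)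

theory Defs
  imports "HOL-Analysis.Analysis"
begin

text \<open>
  The ambient space \<open>\<real>\<^sup>N\<close> is a type \<open>'a :: euclidean_space\<close>, with \<open>N = DIM('a)\<close>.  Exponents and
  functions on a set are total functions whose values outside the set are never used.
\<close>

definition vec_angle :: "'a::euclidean_space \<Rightarrow> 'a \<Rightarrow> real"
  where "vec_angle x v = arccos ((x \<bullet> v) / (norm x * norm v))"

text \<open>
  Finite cones in the sense of Adams and Fournier: height \<open>\<rho>\<close>, axis direction \<open>v\<close>, aperture
  angle \<open>\<kappa>\<close>, vertex \<open>x\<close>.
\<close>

definition finite_cone :: "'a::euclidean_space \<Rightarrow> 'a \<Rightarrow> real \<Rightarrow> real \<Rightarrow> 'a set"
  where "finite_cone x v \<rho> \<kappa> =
    {x + z | z. z = 0 \<or> (0 < norm z \<and> norm z \<le> \<rho> \<and> vec_angle z v \<le> \<kappa> / 2)}"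

definition is_finite_cone_at :: "'a::euclidean_space \<Rightarrow> 'a set \<Rightarrow> bool"
  where "is_finite_cone_at x K \<longleftrightarrow>
    (\<exists>v \<rho> \<kappa>. v \<noteq> 0 \<and> 0 < \<rho> \<and> 0 < \<kappa> \<and> \<kappa> \<le> pi \<and> K = finite_cone x v \<rho> \<kappa>)"

definition congruent_sets :: "'a::euclidean_space set \<Rightarrow> 'a set \<Rightarrow> bool"
  where "congruent_sets S T \<longleftrightarrow>
    (\<exists>a g. orthogonal_transformation g \<and> T = (\<lambda>z. a + g z) ` S)"

definition cone_condition :: "'a::euclidean_space set \<Rightarrow> bool"
  where "cone_condition \<Omega> \<longleftrightarrow>
    (\<exists>K x0. is_finite_cone_at x0 K \<and>
      (\<forall>x\<in>\<Omega>. \<exists>Kx. is_finite_cone_at x Kx \<and> congruent_sets K Kx \<and> Kx \<subseteq> \<Omega>))"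

definition lebesgue_var :: "'a::euclidean_space set \<Rightarrow> ('a \<Rightarrow> real) \<Rightarrow> ('a \<Rightarrow> real) set"
  where "lebesgue_var \<Omega> q =
    {u. u \<in> borel_measurable (lebesgue_on \<Omega>) \<and>
        (\<integral>\<^sup>+ x. ennreal (\<bar>u x\<bar> powr q x) \<partial>lebesgue_on \<Omega>) < \<infinity>}"

definition luxemburg_norm :: "'a::euclidean_space set \<Rightarrow> ('a \<Rightarrow> real) \<Rightarrow> ('a \<Rightarrow> real) \<Rightarrow> real"
  where "luxemburg_norm \<Omega> q u =
    Inf {t. 0 < t \<and> (\<integral>\<^sup>+ x. ennreal (\<bar>u x / t\<bar> powr q x) \<partial>lebesgue_on \<Omega>) \<le> 1}"

text \<open>
  The integral over \<open>\<Omega> \<times> \<Omega>\<close> is an iterated integral; the integrand is nonnegative, and jointly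
  measurable for the functions of interest, so this agrees with the product integral.  On the
  null set \<open>x = y\<close> the integrand is \<open>0 / 0 = 0\<close>.
\<close>

definition gagliardo_modular ::
  "'a::euclidean_space set \<Rightarrow> real \<Rightarrow> ('a \<times> 'a \<Rightarrow> real) \<Rightarrow> ('a \<Rightarrow> real) \<Rightarrow> real \<Rightarrow> ennreal"
  where "gagliardo_modular \<Omega> s p u t =
    (\<integral>\<^sup>+ y. (\<integral>\<^sup>+ x. ennreal (\<bar>u x - u y\<bar> powr p (x, y) /
        (t powr p (x, y) * norm (x - y) powr (real DIM('a) + s * p (x, y))))
      \<partial>lebesgue_on \<Omega>) \<partial>lebesgue_on \<Omega>)"

definition diag_exponent :: "('a \<times> 'a \<Rightarrow> real) \<Rightarrow> 'a \<Rightarrow> real"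
  where "diag_exponent p x = p (x, x)"

definition critical_exponent :: "real \<Rightarrow> ('a::euclidean_space \<times> 'a \<Rightarrow> real) \<Rightarrow> 'a \<Rightarrow> real"
  where "critical_exponent s p x =
    real DIM('a) * diag_exponent p x / (real DIM('a) - s * diag_exponent p x)"

definition sobolev_var ::
  "'a::euclidean_space set \<Rightarrow> real \<Rightarrow> ('a \<times> 'a \<Rightarrow> real) \<Rightarrow> ('a \<Rightarrow> real) set"
  where "sobolev_var \<Omega> s p =
    {u \<in> lebesgue_var \<Omega> (diag_exponent p). \<exists>t>0. gagliardo_modular \<Omega> s p u t < \<infinity>}"

definition gagliardo_seminorm ::
  "'a::euclidean_space set \<Rightarrow> real \<Rightarrow> ('a \<times> 'a \<Rightarrow> real) \<Rightarrow> ('a \<Rightarrow> real) \<Rightarrow> real"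
  where "gagliardo_seminorm \<Omega> s p u = Inf {t. 0 < t \<and> gagliardo_modular \<Omega> s p u t < 1}"

definition sobolev_norm ::
  "'a::euclidean_space set \<Rightarrow> real \<Rightarrow> ('a \<times> 'a \<Rightarrow> real) \<Rightarrow> ('a \<Rightarrow> real) \<Rightarrow> real"
  where "sobolev_norm \<Omega> s p u =
    luxemburg_norm \<Omega> (diag_exponent p) u + gagliardo_seminorm \<Omega> s p u"

end

theory Submission
  imports Defs
begin

text \<open>
  By homogeneity of the norms it is enough to bound the modular \<open>\<integral> \<bar>v\<bar>\<^bsup>q\<^esup>\<close> uniformly over all \<open>v\<close>
  whose two modulars, the one with exponent \<open>p(x, x)\<close> and the Gagliardo one, are at most \<open>1\<close>.  Such a
  bound with constant \<open>C \<ge> 1\<close> gives the embedding with the same constant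
  (\<open>embedding_of_modular_bounded\<close>), because dividing \<open>v\<close> by \<open>C\<close> divides a modular with exponents
  at least \<open>1\<close> by at least \<open>C\<close>.

  The cone condition enters through measure density: a ball of small radius \<open>r\<close> centred in \<open>\<Omega>\<close>
  meets \<open>\<Omega>\<close> in a set \<open>B\<close> of measure at least \<open>c r\<^sup>N\<close>.  Averaging
  \<open>\<bar>v y\<bar> \<le> \<bar>v x\<bar> + \<bar>v x - v y\<bar>\<close> over \<open>x \<in> B\<close> bounds \<open>\<bar>v y\<bar>\<close> at every scale \<open>r\<close>.  Suppose
  that the modular of some exponent \<open>q1\<close> is already under control, and let \<open>Q\<close> and \<open>P\<close> be lower
  bounds for \<open>q1 x\<close> and \<open>p(x, y)\<close> near \<open>y\<close>.  Splitting both averaged terms at the height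
  \<open>l = r\<^bsup>-N/Q\<^esup>\<close> gives
  \<open>\<bar>v y\<bar> \<le> A l (1 + (r\<^bsup>s\<^esup> / l)\<^bsup>P\<^esup> G y)\<close>, where \<open>G y\<close> is the inner Gagliardo integral at \<open>y\<close>
  (\<open>pointwise_bound_at_scale\<close>).  If \<open>\<bar>v y\<bar>\<close> is large, the scale with \<open>\<bar>v y\<bar> = 2 A l\<close> is
  admissible, and there the second summand must dominate:
  \<open>(\<bar>v y\<bar> / 2A)\<^bsup>P (1 + s Q / N)\<^esup> \<le> G y\<close> (\<open>level_bound_of_scales\<close>).
  Since \<open>\<integral> G \<le> 1\<close>, this controls every exponent between \<open>p(x, x)\<close> and slightly below
  \<open>p(x, x) (1 + s q1 x / N)\<close>
  (\<open>modular_bounded_step\<close>); uniform continuity makes the loss caused by \<open>P\<close> and \<open>Q\<close> as small as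
  desired at one radius for all \<open>y\<close>.

  The map \<open>t \<mapsto> p(x, x) (1 + s t / N)\<close> has the critical exponent as its fixed point and exceeds
  \<open>t\<close> by a fixed amount as long as \<open>t\<close> stays a fixed distance below that point.  Starting from
  \<open>q1 x = p(x, x)\<close>, where the modular is at most \<open>1\<close>, finitely many steps of fixed size therefore
  reach \<open>q\<close> (\<open>modular_bounded_subcritical\<close>).
\<close>

section \<open>Cones and measure density\<close>

text \<open>
  Without the angle, the cone is visibly invariant under shrinking towards its vertex and has an
  interior cut out by strict inequalities.
\<close>

lemma finite_cone_eq:
  assumes "v \<noteq> 0" "0 < \<rho>" "0 < \<kappa>" "\<kappa> \<le> pi"
  shows "finite_cone x v \<rho> \<kappa> =
    (+) x ` {z. norm z \<le> \<rho> \<and> cos (\<kappa> / 2) * (norm z * norm v) \<le> z \<bullet> v}"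
proof -
  have angle: "vec_angle z v \<le> \<kappa> / 2 \<longleftrightarrow> cos (\<kappa> / 2) * (norm z * norm v) \<le> z \<bullet> v"
    if "z \<noteq> 0" for z
  proof -
    let ?t = "(z \<bullet> v) / (norm z * norm v)"
    have pos: "0 < norm z * norm v" using that assms by simp
    have t: "\<bar>?t\<bar> \<le> 1"
      using Cauchy_Schwarz_ineq2[of z v] pos by (simp add: abs_mult divide_le_eq)
    have k: "arccos (cos (\<kappa> / 2)) = \<kappa> / 2" by (rule arccos_cos) (use assms in auto)
    have "arccos ?t \<le> \<kappa> / 2 \<longleftrightarrow> arccos ?t \<le> arccos (cos (\<kappa> / 2))" by (simp add: k)
    also have "\<dots> \<longleftrightarrow> cos (\<kappa> / 2) \<le> ?t"
      by (rule arccos_le_mono) (use t in auto)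
    also have "\<dots> \<longleftrightarrow> cos (\<kappa> / 2) * (norm z * norm v) \<le> z \<bullet> v"
      using pos by (simp add: le_divide_eq)
    finally show ?thesis by (simp add: vec_angle_def)
  qed
  have "(z = 0 \<or> (0 < norm z \<and> norm z \<le> \<rho> \<and> vec_angle z v \<le> \<kappa> / 2)) \<longleftrightarrow>
    (norm z \<le> \<rho> \<and> cos (\<kappa> / 2) * (norm z * norm v) \<le> z \<bullet> v)" for z
    using angle[of z] assms(2) by (cases "z = 0") auto
  then show ?thesis unfolding finite_cone_def by auto
qed

lemma finite_cone_contains_cball:
  fixes v :: "'a::euclidean_space"
  assumes "v \<noteq> 0" "0 < \<rho>" "0 < \<kappa>" "\<kappa> \<le> pi"
  obtains c e where "0 < e" "cball c e \<subseteq> finite_cone x v \<rho> \<kappa>"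
proof -
  define S where "S = {z. norm z < \<rho> \<and> cos (\<kappa> / 2) * (norm z * norm v) < z \<bullet> v}"
  have op: "open S" unfolding S_def
    by (intro open_Collect_conj open_Collect_less continuous_intros)
  have "cos (\<kappa> / 2) < cos 0"
    by (rule cos_monotone_0_pi) (use assms in auto)
  then have "cos (\<kappa> / 2) * (\<rho> / 2 * norm v) < \<rho> / 2 * norm v"
    using assms mult_strict_right_mono[of "cos (\<kappa> / 2)" 1 "\<rho> / 2 * norm v"] by auto
  then have "(\<rho> / 2 / norm v) *\<^sub>R v \<in> S"
    using assms by (simp add: S_def dot_square_norm power2_eq_square)
  then obtain e where e: "0 < e" "cball ((\<rho> / 2 / norm v) *\<^sub>R v) e \<subseteq> S"
    using op open_contains_cball by blast
  have "cball (x + (\<rho> / 2 / norm v) *\<^sub>R v) e = (+) x ` cball ((\<rho> / 2 / norm v) *\<^sub>R v) e"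
    by (metis cball_translation)
  also have "\<dots> \<subseteq> (+) x ` {z. norm z \<le> \<rho> \<and> cos (\<kappa> / 2) * (norm z * norm v) \<le> z \<bullet> v}"
    using e(2) by (intro image_mono) (auto simp: S_def)
  finally show ?thesis
    using that[OF e(1)] finite_cone_eq[OF assms, of x] by auto
qed

lemma finite_cone_shrink:
  assumes "v \<noteq> 0" "0 < \<rho>" "0 < \<kappa>" "\<kappa> \<le> pi" "0 \<le> l" "l \<le> 1"
    and "w \<in> finite_cone x v \<rho> \<kappa>"
  shows "x + l *\<^sub>R (w - x) \<in> finite_cone x v \<rho> \<kappa> \<inter> cball x (l * \<rho>)"
proof -
  obtain z where z: "w = x + z" "norm z \<le> \<rho>" "cos (\<kappa> / 2) * (norm z * norm v) \<le> z \<bullet> v"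
    using assms(7) unfolding finite_cone_eq[OF assms(1-4)] by auto
  have "norm (l *\<^sub>R z) \<le> l * \<rho>" using z(2) assms(5) by (simp add: mult_left_mono)
  moreover have "l * \<rho> \<le> 1 * \<rho>" using assms by (intro mult_right_mono) auto
  moreover have "cos (\<kappa> / 2) * (norm (l *\<^sub>R z) * norm v) \<le> (l *\<^sub>R z) \<bullet> v"
    using mult_left_mono[OF z(3) assms(5)] assms(5) by (simp add: ac_simps)
  ultimately show ?thesis unfolding finite_cone_eq[OF assms(1-4)]
    using z(1) by (auto simp: dist_norm)
qed

text \<open>
  The cones at the points of \<open>\<Omega>\<close> are congruent, so all of them contain a ball of the same radius
  \<open>e\<close>.  Shrinking the cone at \<open>x\<close> towards \<open>x\<close> by the factor \<open>r / R\<close>, where \<open>R\<close> bounds the heights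
  of all cones, moves it into \<open>cball x r\<close> and the ball to one of radius \<open>e r / R\<close>.
\<close>

lemma cone_condition_interior_balls:
  fixes \<Omega> :: "'a::euclidean_space set"
  assumes "cone_condition \<Omega>"
  obtains \<epsilon> R where "0 < \<epsilon>" "0 < R"
    "\<And>x r. x \<in> \<Omega> \<Longrightarrow> 0 < r \<Longrightarrow> r \<le> R \<Longrightarrow> \<exists>c. cball c (\<epsilon> * r) \<subseteq> \<Omega> \<inter> cball x r"
proof -
  obtain K x0 where K: "is_finite_cone_at x0 K"
    and cong: "\<And>x. x \<in> \<Omega> \<Longrightarrow> \<exists>Kx. is_finite_cone_at x Kx \<and> congruent_sets K Kx \<and> Kx \<subseteq> \<Omega>"
    using assms unfolding cone_condition_def by blast
  obtain v \<rho> \<kappa> where v: "v \<noteq> 0" "0 < \<rho>" "0 < \<kappa>" "\<kappa> \<le> pi" and Keq: "K = finite_cone x0 v \<rho> \<kappa>"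
    using K unfolding is_finite_cone_at_def by blast
  obtain k e where e: "0 < e" "cball k e \<subseteq> K"
    using finite_cone_contains_cball[OF v] Keq by metis
  have Kb: "K \<subseteq> cball x0 \<rho>" unfolding Keq finite_cone_eq[OF v] by (auto simp: dist_norm)
  define R where "R = 2 * \<rho>"
  show thesis
  proof (rule that)
    show "0 < e / R" "0 < R" using e(1) v(2) by (auto simp: R_def)
    fix x r assume x: "x \<in> \<Omega>" and r: "0 < r" "r \<le> R"
    obtain Kx where Kx: "is_finite_cone_at x Kx" "congruent_sets K Kx" "Kx \<subseteq> \<Omega>"
      using cong[OF x] by blast
    obtain v' \<rho>' \<kappa>' where v': "v' \<noteq> 0" "0 < \<rho>'" "0 < \<kappa>'" "\<kappa>' \<le> pi"
      and Kxeq: "Kx = finite_cone x v' \<rho>' \<kappa>'"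
      using Kx(1) unfolding is_finite_cone_at_def by blast
    obtain a g where g: "orthogonal_transformation g" "Kx = (\<lambda>z. a + g z) ` K"
      using Kx(2) unfolding congruent_sets_def by blast
    have "cball (a + g k) e = (+) a ` (g ` cball k e)"
      by (metis cball_translation g(1) image_orthogonal_transformation_cball)
    also have "\<dots> \<subseteq> Kx" using e(2) g(2) by (auto simp: image_image)
    finally have ball: "cball (a + g k) e \<subseteq> Kx" .
    \<comment> \<open>The congruence is not assumed to send vertex to vertex, so the heights of \<open>K\<close> and \<open>Kx\<close>
      are compared through the diameter, which it preserves.\<close>
    have "\<rho>' \<le> R"
    proof -
      have "x \<in> Kx" "x + (\<rho>' / norm v') *\<^sub>R v' \<in> Kx"
        using v' unfolding Kxeq finite_cone_eq[OF v']
        by (auto simp: dot_square_norm power2_eq_square mult_le_cancel_right1)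
      then obtain z1 z2 where z: "z1 \<in> K" "z2 \<in> K" "x = a + g z1"
          "x + (\<rho>' / norm v') *\<^sub>R v' = a + g z2"
        unfolding g(2) by blast
      have "\<rho>' = norm ((\<rho>' / norm v') *\<^sub>R v')" using v' by simp
      also have "(\<rho>' / norm v') *\<^sub>R v' = g z2 - g z1" using z(3,4) by (simp add: algebra_simps)
      also have "norm (g z2 - g z1) = dist z2 z1"
        using g(1) by (metis dist_norm orthogonal_transformation_isometry)
      also have "\<dots> \<le> dist x0 z2 + dist x0 z1" by (metis dist_commute dist_triangle)
      also have "\<dots> \<le> \<rho> + \<rho>" using z(1,2) Kb by (intro add_mono) auto
      finally show ?thesis by (simp add: R_def)
    qed
    define l where "l = r / R"
    have l: "0 < l" "l \<le> 1" using r by (auto simp: l_def)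
    have "cball (x + l *\<^sub>R ((a + g k) - x)) (e / R * r) \<subseteq> \<Omega> \<inter> cball x r"
    proof
      fix w assume w: "w \<in> cball (x + l *\<^sub>R ((a + g k) - x)) (e / R * r)"
      define w' where "w' = x + (1 / l) *\<^sub>R (w - x)"
      have ww: "w = x + l *\<^sub>R (w' - x)" using l by (simp add: w'_def)
      have "dist (x + l *\<^sub>R ((a + g k) - x)) w = l * dist (a + g k) w'"
      proof -
        have "x + l *\<^sub>R ((a + g k) - x) - w = l *\<^sub>R ((a + g k) - w')"
          unfolding ww by (simp add: algebra_simps)
        then show ?thesis using l by (simp add: dist_norm)
      qed
      then have "l * dist (a + g k) w' \<le> l * e" using w by (simp add: l_def mult.commute)
      then have "w' \<in> Kx" using l ball by auto
      then have "w \<in> Kx \<inter> cball x (l * \<rho>')"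
        unfolding ww Kxeq using finite_cone_shrink[OF v', of l] l by auto
      moreover have "l * \<rho>' \<le> r"
        using mult_left_mono[OF \<open>\<rho>' \<le> R\<close>, of l] l r by (simp add: l_def)
      ultimately show "w \<in> \<Omega> \<inter> cball x r" using Kx(3) by auto
    qed
    then show "\<exists>c. cball c (e / R * r) \<subseteq> \<Omega> \<inter> cball x r" by blast
  qed
qed

definition measure_density :: "'a::euclidean_space set \<Rightarrow> real \<Rightarrow> real \<Rightarrow> bool"
  where "measure_density \<Omega> c R \<longleftrightarrow> 0 < c \<and> 0 < R \<and>
    (\<forall>x\<in>\<Omega>. \<forall>r. 0 < r \<longrightarrow> r \<le> R \<longrightarrow> c * r powr DIM('a) \<le> measure lebesgue (\<Omega> \<inter> cball x r))"

lemma cone_condition_measure_density: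
  fixes \<Omega> :: "'a::euclidean_space set"
  assumes "cone_condition \<Omega>" "\<Omega> \<in> sets lebesgue"
  obtains c R where "measure_density \<Omega> c R"
proof -
  obtain \<epsilon> R where \<epsilon>: "0 < \<epsilon>" "0 < R" and balls:
    "\<And>x r. x \<in> \<Omega> \<Longrightarrow> 0 < r \<Longrightarrow> r \<le> R \<Longrightarrow> \<exists>c. cball c (\<epsilon> * r) \<subseteq> \<Omega> \<inter> cball x r"
    using cone_condition_interior_balls[OF assms(1)] by metis
  have "unit_ball_vol DIM('a) * \<epsilon> ^ DIM('a) * r powr DIM('a) \<le> measure lebesgue (\<Omega> \<inter> cball x r)"
    if x: "x \<in> \<Omega>" and r: "0 < r" "r \<le> R" for x r
  proof -
    obtain c where c: "cball c (\<epsilon> * r) \<subseteq> \<Omega> \<inter> cball x r" using balls[OF x r] by blast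
    have "\<Omega> \<inter> cball x r \<in> lmeasurable"
      by (metis Int_commute assms(2) fmeasurable_Int_fmeasurable lmeasurable_cball)
    then have "measure lebesgue (cball c (\<epsilon> * r)) \<le> measure lebesgue (\<Omega> \<inter> cball x r)"
      using c by (intro measure_mono_fmeasurable) auto
    moreover have "measure lebesgue (cball c (\<epsilon> * r)) = unit_ball_vol DIM('a) * (\<epsilon> * r) ^ DIM('a)"
      using content_cball[of "\<epsilon> * r" c] \<epsilon> r by simp
    ultimately show ?thesis using r by (simp add: powr_realpow power_mult_distrib)
  qed
  then show thesis
    using that[of "unit_ball_vol DIM('a) * \<epsilon> ^ DIM('a)" R] \<epsilon>
    by (simp add: measure_density_def)
qed

section \<open>The pointwise estimate\<close>

definition gagliardo_slice ::
  "'a::euclidean_space set \<Rightarrow> real \<Rightarrow> ('a \<times> 'a \<Rightarrow> real) \<Rightarrow> ('a \<Rightarrow> real) \<Rightarrow> 'a \<Rightarrow> ennreal"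
  where "gagliardo_slice \<Omega> s p v y =
    (\<integral>\<^sup>+ x. ennreal (\<bar>v x - v y\<bar> powr p (x, y) / norm (x - y) powr (real DIM('a) + s * p (x, y)))
      \<partial>lebesgue_on \<Omega>)"

text \<open>
  This replaces Hoelder's inequality in the averages below: the height \<open>l\<close> is the same for all points,
  while the exponent \<open>a\<close> may vary from point to point.
\<close>

lemma le_add_powr:
  fixes t l a :: real
  assumes "0 \<le> t" "0 < l" "1 \<le> a"
  shows "t \<le> l + l powr (1 - a) * t powr a"
proof (cases "t \<le> l")
  case True
  then show ?thesis by (simp add: add_increasing2)
next
  case False
  have "1 \<le> (t / l) powr (a - 1)" using False assms by (intro ge_one_powr_ge_zero) auto
  then have "t * 1 \<le> t * (t / l) powr (a - 1)" using assms by (intro mult_left_mono) auto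
  also have "\<dots> = l powr (1 - a) * t powr a"
    using assms False by (simp add: powr_divide powr_diff field_simps)
  finally show ?thesis using assms by simp
qed

text \<open>
  The average of \<open>\<bar>v x\<bar>\<close> over \<open>B\<close> costs the factor \<open>1 / \<bar>B\<bar> \<le> r\<^bsup>-N\<^esup> / c\<close> on the modular of \<open>v\<close>, and
  the height \<open>l = r\<^bsup>-N/Q\<^esup>\<close> is the one for which \<open>l\<^bsup>1-Q\<^esup> r\<^bsup>-N\<^esup> = l\<close>.  The same height is used for the
  oscillation \<open>\<bar>v x - v y\<bar>\<close>; its power is at most \<open>r\<^bsup>N + s p(x, y)\<^esup>\<close> times the Gagliardo integrand.
  As \<open>r \<le> 1 \<le> l\<close>, all variable exponents can be replaced by their lower bounds \<open>Q\<close> and \<open>P\<close>.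
\<close>

lemma pointwise_bound_at_scale:
  fixes \<Omega> :: "'a::euclidean_space set"
  assumes dens: "measure_density \<Omega> c R" and \<Omega>: "\<Omega> \<in> sets lebesgue"
    and y: "y \<in> \<Omega>" and r: "0 < r" "r \<le> R" "r \<le> 1" and s: "0 < s"
    and v [measurable]: "v \<in> borel_measurable (lebesgue_on \<Omega>)"
    and q [measurable]: "q \<in> borel_measurable (lebesgue_on \<Omega>)"
    and p [measurable]: "(\<lambda>x. p (x, y)) \<in> borel_measurable (lebesgue_on \<Omega>)"
    and Q: "0 < Q" "\<And>x. x \<in> \<Omega> \<inter> cball y r \<Longrightarrow> Q \<le> q x \<and> 1 \<le> q x"
    and P: "\<And>x. x \<in> \<Omega> \<inter> cball y r \<Longrightarrow> P \<le> p (x, y) \<and> 1 \<le> p (x, y)"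
    and C: "(\<integral>\<^sup>+ x. ennreal (\<bar>v x\<bar> powr q x) \<partial>lebesgue_on \<Omega>) \<le> ennreal C" "0 \<le> C"
    and g: "gagliardo_slice \<Omega> s p v y = ennreal g" "0 \<le> g"
  shows "\<bar>v y\<bar> \<le> (2 + C / c + 1 / c) * r powr (- (DIM('a) / Q)) *
    (1 + r powr ((s + DIM('a) / Q) * P) * g)"
proof -
  define N where "N = real DIM('a)"
  define l where "l = r powr (- (N / Q))"
  define B where "B = \<Omega> \<inter> cball y r"
  define m where "m = measure lebesgue B"
  define a where "a = l powr (1 - Q)"
  define b where "b = l powr (1 - P) * r powr (N + s * P)"
  define f where "f x = \<bar>v x\<bar> powr q x" for x
  define k where "k x = \<bar>v x - v y\<bar> powr p (x, y) / norm (x - y) powr (N + s * p (x, y))" for x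
  let ?M = "lebesgue_on \<Omega>"
  have N: "0 < N" by (simp add: N_def)
  have c: "0 < c" using dens by (simp add: measure_density_def)
  have l1: "1 \<le> l" unfolding l_def using r N Q by (simp add: powr_minus_divide powr_le1)
  have Bm: "B \<in> lmeasurable" unfolding B_def
    by (metis Int_commute \<Omega> fmeasurable_Int_fmeasurable lmeasurable_cball)
  have BM [measurable]: "B \<in> sets ?M"
    using Bm \<Omega> by (auto simp: B_def sets_restrict_space_iff fmeasurable_def)
  have emB: "emeasure ?M B = ennreal m"
    unfolding m_def using Bm \<Omega>
    by (subst emeasure_restrict_space) (auto simp: B_def emeasure_eq_measure2)
  have m: "c * r powr N \<le> m" unfolding m_def B_def N_def
    using dens y r by (simp add: measure_density_def)
  have m0: "0 < m" using m c r by (smt (verit) mult_pos_pos powr_gt_zero)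
  have ab: "0 \<le> a" "0 \<le> b" by (auto simp: a_def b_def)
  have f_meas [measurable]: "f \<in> borel_measurable ?M" unfolding f_def by measurable
  have k_meas [measurable]: "k \<in> borel_measurable ?M"
  proof -
    have [measurable]: "(\<lambda>x. norm (x - y)) \<in> borel_measurable ?M"
      by (intro continuous_imp_measurable_on_sets_lebesgue \<Omega> continuous_intros)
    show ?thesis unfolding k_def by measurable
  qed
  have osc: "\<bar>v x - v y\<bar> \<le> l + b * k x" if "x \<in> B" for x
  proof (cases "x = y")
    case True
    then show ?thesis using l1 by (simp add: k_def)
  next
    case False
    define d where "d = norm (x - y)"
    have d: "0 < d" "d \<le> r"
      using False that by (auto simp: d_def B_def dist_norm norm_minus_commute)
    have P': "P \<le> p (x, y)" "1 \<le> p (x, y)" using P[of x] that by (auto simp: B_def)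
    have "\<bar>v x - v y\<bar> \<le> l + l powr (1 - p (x, y)) * \<bar>v x - v y\<bar> powr p (x, y)"
      using le_add_powr[of "\<bar>v x - v y\<bar>" l "p (x, y)"] l1 P' by auto
    also have "\<bar>v x - v y\<bar> powr p (x, y) = d powr (N + s * p (x, y)) * k x"
      using d by (simp add: k_def d_def)
    also have "l powr (1 - p (x, y)) * (d powr (N + s * p (x, y)) * k x) \<le> b * k x"
    proof -
      have "d powr (N + s * p (x, y)) \<le> r powr (N + s * p (x, y))"
        using d N s P' by (intro powr_mono2) auto
      also have "\<dots> \<le> r powr (N + s * P)"
        using r s P' by (intro powr_mono') auto
      finally have "l powr (1 - p (x, y)) * d powr (N + s * p (x, y)) \<le> b"
        unfolding b_def using l1 P' by (intro mult_mono powr_mono) auto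
      moreover have "0 \<le> k x" by (simp add: k_def)
      ultimately show ?thesis by (simp add: mult_right_mono flip: mult.assoc)
    qed
    finally show ?thesis by simp
  qed
  have size: "\<bar>v x\<bar> \<le> l + a * f x" if "x \<in> B" for x
  proof -
    have Q': "Q \<le> q x" "1 \<le> q x" using Q(2)[of x] that by (auto simp: B_def)
    have "\<bar>v x\<bar> \<le> l + l powr (1 - q x) * \<bar>v x\<bar> powr q x"
      using le_add_powr[of "\<bar>v x\<bar>" l "q x"] l1 Q' by auto
    also have "l powr (1 - q x) * \<bar>v x\<bar> powr q x \<le> a * f x"
      unfolding a_def f_def using l1 Q' by (intro mult_right_mono powr_mono) auto
    finally show ?thesis by simp
  qed
  have pw: "ennreal \<bar>v y\<bar> * indicator B x \<le>
      ennreal (2 * l) * indicator B x + (ennreal a * ennreal (f x) + ennreal b * ennreal (k x))" for x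
  proof (cases "x \<in> B")
    case True
    have "\<bar>v y\<bar> \<le> 2 * l + (a * f x + b * k x)" using osc[OF True] size[OF True] by linarith
    moreover have "0 \<le> f x" "0 \<le> k x" by (auto simp: f_def k_def)
    ultimately show ?thesis using True l1 ab by (simp flip: ennreal_mult ennreal_plus)
  qed simp
  have "ennreal (\<bar>v y\<bar> * m) = (\<integral>\<^sup>+ x. ennreal \<bar>v y\<bar> * indicator B x \<partial>?M)"
    using m0 by (simp add: nn_integral_cmult_indicator emB ennreal_mult)
  also have "\<dots> \<le> (\<integral>\<^sup>+ x. ennreal (2 * l) * indicator B x +
      (ennreal a * ennreal (f x) + ennreal b * ennreal (k x)) \<partial>?M)"
    by (intro nn_integral_mono pw)
  also have "\<dots> = ennreal (2 * l) * ennreal m +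
      (ennreal a * (\<integral>\<^sup>+ x. ennreal (f x) \<partial>?M) + ennreal b * (\<integral>\<^sup>+ x. ennreal (k x) \<partial>?M))"
    by (simp add: nn_integral_add nn_integral_cmult nn_integral_cmult_indicator emB)
  also have "(\<integral>\<^sup>+ x. ennreal (k x) \<partial>?M) = ennreal g"
    using g(1) by (simp add: gagliardo_slice_def k_def N_def)
  also have "ennreal (2 * l) * ennreal m +
      (ennreal a * (\<integral>\<^sup>+ x. ennreal (f x) \<partial>?M) + ennreal b * ennreal g) \<le>
      ennreal (2 * l) * ennreal m + (ennreal a * ennreal C + ennreal b * ennreal g)"
    using C(1) by (intro add_mono mult_left_mono) (auto simp: f_def)
  also have "\<dots> = ennreal (2 * l * m + (a * C + b * g))"
    using l1 m0 ab C g by (simp add: ennreal_mult ennreal_plus)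
  finally have "\<bar>v y\<bar> * m \<le> 2 * l * m + (a * C + b * g)"
    using l1 m0 ab C g by (subst (asm) ennreal_le_iff) auto
  then have "\<bar>v y\<bar> \<le> 2 * l + (a * C + b * g) / m" using m0 by (simp add: field_simps)
  also have "(a * C + b * g) / m \<le> (a * C + b * g) / (c * r powr N)"
    using m m0 c r ab C g by (intro divide_left_mono mult_pos_pos add_nonneg_nonneg) auto
  also have "a = l * r powr N"
  proof -
    have "- (N / Q) * (1 - Q) = - (N / Q) + N" using Q by (simp add: field_simps)
    then show ?thesis by (simp only: a_def l_def powr_powr powr_add)
  qed
  also have "b = l * r powr N * r powr ((s + N / Q) * P)"
  proof -
    have "- (N / Q) * (1 - P) + (N + s * P) = - (N / Q) + N + (s + N / Q) * P"
      using Q by (simp add: field_simps)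
    then show ?thesis by (simp only: b_def l_def powr_powr flip: powr_add)
  qed
  also have "2 * l + (l * r powr N * C + l * r powr N * r powr ((s + N / Q) * P) * g) / (c * r powr N) =
      l * (2 + C / c + (1 / c) * (r powr ((s + N / Q) * P) * g))"
    using r c by (simp add: field_simps)
  also have "\<dots> \<le> l * ((2 + C / c + 1 / c) * (1 + r powr ((s + N / Q) * P) * g))"
  proof (intro mult_left_mono)
    define h where "h = r powr ((s + N / Q) * P) * g"
    have "0 \<le> h" using g by (simp add: h_def)
    then have "0 \<le> 1 / c + 2 * h + C / c * h" using c C by simp
    then show "2 + C / c + 1 / c * (r powr ((s + N / Q) * P) * g) \<le>
      (2 + C / c + 1 / c) * (1 + r powr ((s + N / Q) * P) * g)"
      unfolding h_def[symmetric] by (simp add: algebra_simps add_divide_distrib)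
  qed (use l1 in auto)
  finally show ?thesis by (simp add: l_def N_def mult.commute mult.left_commute)
qed

text \<open>
  At the scale where \<open>t = 2 A r\<^bsup>-N/Q\<^esup>\<close> the bound reads \<open>2 \<le> 1 + r\<^bsup>(s + N/Q) P\<^esup> g\<close>, and
  \<open>(s + N/Q) P\<close> is \<open>N/Q\<close> times \<open>P (1 + s Q / N)\<close>.
\<close>

lemma level_bound_of_scales:
  fixes t A N Q P s g r0 :: real
  assumes "0 < A" "0 < N" "0 < Q" "0 \<le> P" "0 < s" "0 < r0"
    and bound: "\<And>r. 0 < r \<Longrightarrow> r \<le> r0 \<Longrightarrow>
      t \<le> A * r powr (- (N / Q)) * (1 + r powr ((s + N / Q) * P) * g)"
    and large: "2 * A * r0 powr (- (N / Q)) \<le> t"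
  shows "(t / (2 * A)) powr (P * (1 + s * Q / N)) \<le> g"
proof -
  define T where "T = t / (2 * A)"
  have T: "r0 powr (- (N / Q)) \<le> T" using large assms by (simp add: T_def field_simps)
  have T0: "0 < T" using T assms by (smt (verit) powr_gt_zero)
  define r where "r = T powr (- (Q / N))"
  have r: "0 < r" using T0 by (simp add: r_def)
  have "r \<le> (r0 powr (- (N / Q))) powr (- (Q / N))"
    unfolding r_def using T assms by (intro powr_mono2') auto
  also have "\<dots> = r0" using assms by (simp add: powr_powr)
  finally have r0: "r \<le> r0" .
  have rT: "r powr (- (N / Q)) = T" using T0 assms by (simp add: r_def powr_powr)
  have rP: "r powr ((s + N / Q) * P) = T powr (- (P * (1 + s * Q / N)))"
  proof -
    have "- (Q / N) * ((s + N / Q) * P) = - (P * (1 + s * Q / N))"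
      using assms by (simp add: field_simps)
    then show ?thesis by (simp only: r_def powr_powr)
  qed
  have "2 * A * T \<le> A * T * (1 + T powr (- (P * (1 + s * Q / N))) * g)"
    using bound[OF r r0] assms unfolding rT rP by (simp add: T_def)
  then have "2 \<le> 1 + T powr (- (P * (1 + s * Q / N))) * g"
    using assms T0 mult_le_cancel_left_pos[of "A * T" 2] by (simp add: ac_simps)
  then have "1 \<le> g / T powr (P * (1 + s * Q / N))"
    by (simp add: powr_minus_divide)
  then show ?thesis using T0 by (simp add: T_def[symmetric] le_divide_eq)
qed

text \<open>
  Stated for arbitrary \<open>f\<close> because it is applied to \<open>gagliardo_slice\<close>, a parameter integral whose
  measurability would require a Fubini argument on \<open>\<Omega> \<times> \<Omega>\<close>.  Multiplication by \<open>1 / c\<close> takes the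
  simple functions below \<open>c f\<close> to simple functions below \<open>f\<close>.
\<close>

lemma nn_integral_cmult_le:
  fixes c :: real
  assumes "0 < c"
  shows "(\<integral>\<^sup>+ x. ennreal c * f x \<partial>M) \<le> ennreal c * (\<integral>\<^sup>+ x. f x \<partial>M)"
  unfolding nn_integral_def[of M "\<lambda>x. ennreal c * f x"]
proof (safe intro!: SUP_least)
  fix h assume h: "simple_function M h" "h \<le> (\<lambda>x. ennreal c * f x)"
  have inv: "ennreal c * (ennreal (1 / c) * z) = z" for z
    using assms by (simp flip: mult.assoc ennreal_mult)
  have inv': "ennreal (1 / c) * (ennreal c * z) = z" for z
    using assms by (simp flip: mult.assoc ennreal_mult)
  have "integral\<^sup>S M h = ennreal c * (ennreal (1 / c) * integral\<^sup>S M h)" by (simp add: inv)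
  also have "ennreal (1 / c) * integral\<^sup>S M h = (\<integral>\<^sup>Sx. ennreal (1 / c) * h x \<partial>M)"
    using h(1) by simp
  also have "\<dots> \<le> (\<integral>\<^sup>+ x. f x \<partial>M)"
    unfolding nn_integral_def
  proof (rule SUP_upper, safe)
    show "simple_function M (\<lambda>x. ennreal (1 / c) * h x)" using h(1) by simp
    show "(\<lambda>x. ennreal (1 / c) * h x) \<le> f"
      using h(2) inv' by (metis (mono_tags, lifting) le_fun_def mult_left_mono zero_le)
  qed
  finally show "integral\<^sup>S M h \<le> ennreal c * integral\<^sup>N M f"
    by (simp add: mult_left_mono)
qed

section \<open>Improving the exponent\<close>

definition unit_modular_class ::
  "'a::euclidean_space set \<Rightarrow> real \<Rightarrow> ('a \<times> 'a \<Rightarrow> real) \<Rightarrow> ('a \<Rightarrow> real) set"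
  where "unit_modular_class \<Omega> s p =
    {v \<in> borel_measurable (lebesgue_on \<Omega>).
      (\<integral>\<^sup>+ x. ennreal (\<bar>v x\<bar> powr diag_exponent p x) \<partial>lebesgue_on \<Omega>) \<le> 1 \<and>
      (\<integral>\<^sup>+ y. gagliardo_slice \<Omega> s p v y \<partial>lebesgue_on \<Omega>) \<le> 1}"

definition modular_bounded ::
  "'a::euclidean_space set \<Rightarrow> real \<Rightarrow> ('a \<times> 'a \<Rightarrow> real) \<Rightarrow> ('a \<Rightarrow> real) \<Rightarrow> bool"
  where "modular_bounded \<Omega> s p q \<longleftrightarrow> (\<exists>C\<ge>0. \<forall>v \<in> unit_modular_class \<Omega> s p.
    (\<integral>\<^sup>+ x. ennreal (\<bar>v x\<bar> powr q x) \<partial>lebesgue_on \<Omega>) \<le> ennreal C)"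

text \<open>
  Where \<open>\<bar>v\<bar>\<close> is at most a constant \<open>M\<close>, the modular with exponent \<open>q2 x \<ge> p(x, x)\<close> is controlled
  by that with exponent \<open>p(x, x)\<close>; where \<open>\<bar>v\<bar>\<close> exceeds \<open>M\<close>, the Gagliardo integral at the point
  dominates.  The margin \<open>\<gamma>\<close> pays for passing from the values of \<open>p\<close> and \<open>q1\<close> at a point to lower
  bounds on a ball.
\<close>

lemma modular_bounded_step:
  fixes \<Omega> :: "'a::euclidean_space set" and pp qq \<gamma> :: real
  assumes dens: "measure_density \<Omega> c R" and \<Omega>: "\<Omega> \<in> sets lebesgue" and s: "0 < s"
    and puc: "uniformly_continuous_on (\<Omega> \<times> \<Omega>) p"
    and p: "\<And>z. z \<in> \<Omega> \<times> \<Omega> \<Longrightarrow> 1 \<le> p z \<and> p z \<le> pp"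
    and quc: "uniformly_continuous_on \<Omega> q1"
    and q1: "\<And>x. x \<in> \<Omega> \<Longrightarrow> 1 \<le> q1 x \<and> q1 x \<le> qq"
    and q2 [measurable]: "q2 \<in> borel_measurable (lebesgue_on \<Omega>)"
    and gain: "0 < \<gamma>" "\<And>x. x \<in> \<Omega> \<Longrightarrow> diag_exponent p x \<le> q2 x \<and>
      q2 x + \<gamma> \<le> diag_exponent p x * (1 + s * q1 x / DIM('a))"
    and bnd: "modular_bounded \<Omega> s p q1"
  shows "modular_bounded \<Omega> s p q2"
proof (cases "\<Omega> = {}")
  case True
  then show ?thesis
    by (auto simp: modular_bounded_def nn_integral_empty intro!: exI[of _ 0])
next
  case False
  let ?M = "lebesgue_on \<Omega>"
  define N where "N = real DIM('a)"
  have N: "0 < N" by (simp add: N_def)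
  obtain C where C: "0 \<le> C" and Cb: "\<And>v. v \<in> unit_modular_class \<Omega> s p \<Longrightarrow>
      (\<integral>\<^sup>+ x. ennreal (\<bar>v x\<bar> powr q1 x) \<partial>?M) \<le> ennreal C"
    using bnd unfolding modular_bounded_def by blast
  have c: "0 < c" "0 < R" using dens by (auto simp: measure_density_def)
  obtain x0 where "x0 \<in> \<Omega>" using False by blast
  then have pq: "1 \<le> pp" "1 \<le> qq" using p[of "(x0, x0)"] q1[of x0] by auto
  \<comment> \<open>\<open>L\<close> is a Lipschitz constant for the loss in \<open>P (1 + s Q / N)\<close> when \<open>P\<close> and \<open>Q\<close> both
    decrease by \<open>\<epsilon>\<close>; the bound \<open>\<epsilon> \<le> 1 / 2\<close> keeps \<open>P\<close> and \<open>Q\<close> above \<open>1 / 2\<close>.\<close>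
  define L where "L = 1 + s * qq / N + pp * s / N"
  have L: "0 < L" unfolding L_def using pq s N by (intro add_pos_nonneg) auto
  define \<epsilon> where "\<epsilon> = min (1 / 2) (\<gamma> / L)"
  have \<epsilon>: "0 < \<epsilon>" "\<epsilon> \<le> 1 / 2" "\<epsilon> * L \<le> \<gamma>"
    using gain(1) L by (auto simp: \<epsilon>_def min_def field_simps)
  obtain \<delta>1 where \<delta>1: "0 < \<delta>1" "\<And>z z'. z \<in> \<Omega> \<times> \<Omega> \<Longrightarrow> z' \<in> \<Omega> \<times> \<Omega> \<Longrightarrow> dist z' z < \<delta>1 \<Longrightarrow> dist (p z') (p z) < \<epsilon>"
    using puc \<epsilon>(1) unfolding uniformly_continuous_on_def by metis
  obtain \<delta>2 where \<delta>2: "0 < \<delta>2" "\<And>z z'. z \<in> \<Omega> \<Longrightarrow> z' \<in> \<Omega> \<Longrightarrow> dist z' z < \<delta>2 \<Longrightarrow> dist (q1 z') (q1 z) < \<epsilon>"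
    using quc \<epsilon>(1) unfolding uniformly_continuous_on_def by metis
  define r0 where "r0 = min (min 1 R) (min (\<delta>1 / 2) (\<delta>2 / 2))"
  have r0: "0 < r0" "r0 \<le> 1" "r0 \<le> R" "r0 < \<delta>1" "r0 < \<delta>2"
    using c \<delta>1(1) \<delta>2(1) by (auto simp: r0_def)
  define A where "A = 2 + C / c + 1 / c"
  have A: "2 \<le> A" using c C by (simp add: A_def)
  \<comment> \<open>A scale below \<open>r0\<close> is available at \<open>y\<close> once \<open>\<bar>v y\<bar> \<ge> 2 A r0\<^bsup>-N/Q\<^esup>\<close>.  As \<open>r0 \<le> 1\<close> and
    \<open>Q \<ge> 1 / 2\<close>, the number \<open>M\<close> is at least this threshold for every \<open>y\<close>.\<close>
  define M where "M = 2 * A * r0 powr (- (2 * N))"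
  have M: "1 \<le> M"
  proof -
    have "1 \<le> r0 powr (- (2 * N))" using r0 N by (simp add: powr_minus_divide powr_le1)
    then have "1 * 1 \<le> (2 * A) * r0 powr (- (2 * N))" using A by (intro mult_mono) auto
    then show ?thesis by (simp add: M_def)
  qed
  define mm where "mm = pp * (1 + s * qq / N)"
  have q1_meas: "q1 \<in> borel_measurable ?M"
    by (intro continuous_imp_measurable_on_sets_lebesgue \<Omega> uniformly_continuous_imp_continuous quc)
  have pc: "continuous_on (\<Omega> \<times> \<Omega>) p" by (rule uniformly_continuous_imp_continuous[OF puc])
  have p_meas: "(\<lambda>x. p (x, y)) \<in> borel_measurable ?M" if "y \<in> \<Omega>" for y
    by (intro continuous_imp_measurable_on_sets_lebesgue \<Omega> continuous_on_compose2[OF pc] continuous_intros)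
      (use that in auto)
  have d_meas [measurable]: "diag_exponent p \<in> borel_measurable ?M"
    unfolding diag_exponent_def
    by (intro continuous_imp_measurable_on_sets_lebesgue \<Omega> continuous_on_compose2[OF pc] continuous_intros)
      auto
  have d: "1 \<le> diag_exponent p x \<and> diag_exponent p x \<le> pp" if "x \<in> \<Omega>" for x
    using p[of "(x, x)"] that by (simp add: diag_exponent_def)
  have q2_le: "q2 x \<le> mm" if x: "x \<in> \<Omega>" for x
  proof -
    have "diag_exponent p x * (1 + s * q1 x / N) \<le> mm" unfolding mm_def
      using d[OF x] q1[OF x] s N
      by (intro mult_mono add_mono divide_right_mono mult_left_mono) auto
    then show ?thesis using gain(1) gain(2)[OF x] by (simp add: N_def)
  qed
  have high: "ennreal (\<bar>v y\<bar> powr q2 y) \<le> ennreal ((2 * A) powr mm) * gagliardo_slice \<Omega> s p v y"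
    if v: "v \<in> unit_modular_class \<Omega> s p" and y: "y \<in> \<Omega>" and big: "M < \<bar>v y\<bar>" for v y
  proof (cases "gagliardo_slice \<Omega> s p v y")
    case top
    then show ?thesis using A by (simp add: ennreal_mult_top)
  next
    case (real g)
    define P where "P = diag_exponent p y - \<epsilon>"
    define Q where "Q = q1 y - \<epsilon>"
    define e where "e = P * (1 + s * Q / N)"
    have PQ: "1 / 2 \<le> P" "1 / 2 \<le> Q" "P \<le> pp" "Q \<le> qq"
      using d[OF y] q1[OF y] \<epsilon> by (auto simp: P_def Q_def)
    have e_ge: "q2 y \<le> e"
    proof -
      have "e = diag_exponent p y * (1 + s * q1 y / N) -
          \<epsilon> * (1 + s * q1 y / N + diag_exponent p y * s / N) + \<epsilon> * \<epsilon> * s / N"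
        using N by (simp add: e_def P_def Q_def field_simps)
      moreover have "\<epsilon> * (1 + s * q1 y / N + diag_exponent p y * s / N) \<le> \<epsilon> * L"
        unfolding L_def using d[OF y] q1[OF y] s N \<epsilon>
        by (intro mult_left_mono add_mono divide_right_mono mult_right_mono) auto
      moreover have "0 \<le> \<epsilon> * \<epsilon> * s / N" using \<epsilon> s N by simp
      ultimately show ?thesis using gain(2)[OF y] \<epsilon>(3) by (simp add: N_def)
    qed
    have e_le: "e \<le> mm" unfolding e_def mm_def using PQ s N pq
      by (intro mult_mono add_mono divide_right_mono mult_left_mono) auto
    have bound: "\<bar>v y\<bar> \<le> A * r powr (- (N / Q)) * (1 + r powr ((s + N / Q) * P) * g)"
      if r: "0 < r" "r \<le> r0" for r
      unfolding A_def N_def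
    proof (rule pointwise_bound_at_scale[OF dens \<Omega> y, where q = q1 and p = p])
      fix x assume x: "x \<in> \<Omega> \<inter> cball y r"
      then have xy: "dist x y \<le> r" "x \<in> \<Omega>" by (auto simp: dist_commute)
      have "dist (q1 x) (q1 y) < \<epsilon>" using \<delta>2(2)[OF y xy(2)] xy r r0 by auto
      then show "Q \<le> q1 x \<and> 1 \<le> q1 x" using q1[OF xy(2)] by (auto simp: Q_def dist_real_def)
      have "dist (p (x, y)) (p (y, y)) < \<epsilon>"
        using xy r r0 y by (intro \<delta>1(2)) (auto simp: dist_Pair_Pair)
      then show "P \<le> p (x, y) \<and> 1 \<le> p (x, y)"
        using p[of "(x, y)"] xy y by (auto simp: P_def diag_exponent_def dist_real_def)
    qed (use r r0 s v y PQ Cb[OF v] C real q1_meas p_meas in \<open>auto simp: unit_modular_class_def\<close>)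
    have "r0 powr (- (N / Q)) \<le> r0 powr (- (2 * N))"
      using r0 N PQ by (intro powr_mono') (auto simp: field_simps)
    then have "2 * A * r0 powr (- (N / Q)) \<le> M" using A by (simp add: M_def mult_left_mono)
    then have lev: "(\<bar>v y\<bar> / (2 * A)) powr e \<le> g"
      unfolding e_def using A N PQ s r0 bound big by (intro level_bound_of_scales[where ?r0.0 = r0]) auto
    have "\<bar>v y\<bar> powr q2 y \<le> \<bar>v y\<bar> powr e" using big M e_ge by (intro powr_mono) auto
    also have "\<dots> = (2 * A) powr e * (\<bar>v y\<bar> / (2 * A)) powr e"
      using A by (simp flip: powr_mult)
    also have "\<dots> \<le> (2 * A) powr mm * g"
      using A e_le lev by (intro mult_mono powr_mono) auto
    finally show ?thesis using real by (simp flip: ennreal_mult)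
  qed
  have low: "\<bar>v y\<bar> powr q2 y \<le> M powr mm * \<bar>v y\<bar> powr diag_exponent p y"
    if y: "y \<in> \<Omega>" and small: "\<bar>v y\<bar> \<le> M" for v y
  proof (cases "v y = 0")
    case False
    have "\<bar>v y\<bar> powr q2 y = \<bar>v y\<bar> powr (q2 y - diag_exponent p y) * \<bar>v y\<bar> powr diag_exponent p y"
      by (simp flip: powr_add)
    also have "\<bar>v y\<bar> powr (q2 y - diag_exponent p y) \<le> M powr (q2 y - diag_exponent p y)"
      using small gain(2)[OF y] by (intro powr_mono2) auto
    also have "\<dots> \<le> M powr mm" using M q2_le[OF y] d[OF y] by (intro powr_mono) auto
    finally show ?thesis by (simp add: mult_right_mono)
  qed simp
  have "(\<integral>\<^sup>+ y. ennreal (\<bar>v y\<bar> powr q2 y) \<partial>?M) \<le> ennreal (M powr mm + (2 * A) powr mm)"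
    if v: "v \<in> unit_modular_class \<Omega> s p" for v
  proof -
    have [measurable]: "v \<in> borel_measurable ?M" using v by (simp add: unit_modular_class_def)
    define h where "h y = (if M < \<bar>v y\<bar> then ennreal (\<bar>v y\<bar> powr q2 y) else 0)" for y
    have [measurable]: "h \<in> borel_measurable ?M" unfolding h_def by measurable
    have "(\<integral>\<^sup>+ y. ennreal (\<bar>v y\<bar> powr q2 y) \<partial>?M) \<le>
      (\<integral>\<^sup>+ y. ennreal (M powr mm) * ennreal (\<bar>v y\<bar> powr diag_exponent p y) + h y \<partial>?M)"
    proof (intro nn_integral_mono)
      fix y assume "y \<in> space ?M"
      then have y: "y \<in> \<Omega>" by simp
      show "ennreal (\<bar>v y\<bar> powr q2 y) \<le> ennreal (M powr mm) * ennreal (\<bar>v y\<bar> powr diag_exponent p y) + h y"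
        using low[OF y, of v] by (cases "M < \<bar>v y\<bar>") (auto simp: h_def simp flip: ennreal_mult)
    qed
    also have "\<dots> = ennreal (M powr mm) * (\<integral>\<^sup>+ y. ennreal (\<bar>v y\<bar> powr diag_exponent p y) \<partial>?M)
        + (\<integral>\<^sup>+ y. h y \<partial>?M)"
      by (simp add: nn_integral_add nn_integral_cmult)
    also have "(\<integral>\<^sup>+ y. h y \<partial>?M) \<le>
        (\<integral>\<^sup>+ y. ennreal ((2 * A) powr mm) * gagliardo_slice \<Omega> s p v y \<partial>?M)"
      using high[OF v] by (intro nn_integral_mono) (auto simp: h_def)
    also have "\<dots> \<le> ennreal ((2 * A) powr mm) * (\<integral>\<^sup>+ y. gagliardo_slice \<Omega> s p v y \<partial>?M)"
      using A by (intro nn_integral_cmult_le) auto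
    also have "ennreal (M powr mm) * (\<integral>\<^sup>+ y. ennreal (\<bar>v y\<bar> powr diag_exponent p y) \<partial>?M) +
        ennreal ((2 * A) powr mm) * (\<integral>\<^sup>+ y. gagliardo_slice \<Omega> s p v y \<partial>?M) \<le>
        ennreal (M powr mm) * 1 + ennreal ((2 * A) powr mm) * 1"
      using v by (intro add_mono mult_left_mono) (auto simp: unit_modular_class_def)
    also have "\<dots> = ennreal (M powr mm + (2 * A) powr mm)" by (simp add: ennreal_plus)
    finally show ?thesis by (simp add: add_left_mono)
  qed
  then show ?thesis unfolding modular_bounded_def
    by (intro exI[of _ "M powr mm + (2 * A) powr mm"]) auto
qed

text \<open>
  With \<open>b = p(x, x)\<close> and critical exponent \<open>b / (1 - s b / N)\<close>, the available gain is
  \<open>b (1 + s t / N) - t = (b / (1 - s b / N) - t) (1 - s b / N)\<close>, which is at least \<open>2 \<gamma>\<close> for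
  \<open>t \<le> q x\<close>.  One \<open>\<gamma>\<close> advances the exponent and the other is the margin of the step, so the
  exponents \<open>min (q x) (b + k \<gamma>)\<close> are reached one after the other.
\<close>

lemma modular_bounded_subcritical:
  fixes \<Omega> :: "'a::euclidean_space set" and pp \<eta> :: real
  assumes dens: "measure_density \<Omega> c R" and \<Omega>: "\<Omega> \<in> sets lebesgue" and s: "0 < s"
    and puc: "uniformly_continuous_on (\<Omega> \<times> \<Omega>) p"
    and p: "\<And>z. z \<in> \<Omega> \<times> \<Omega> \<Longrightarrow> 1 \<le> p z \<and> p z \<le> pp" and spp: "s * pp < DIM('a)"
    and quc: "uniformly_continuous_on \<Omega> q"
    and q: "\<And>x. x \<in> \<Omega> \<Longrightarrow> diag_exponent p x \<le> q x \<and> q x \<le> qq"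
    and gap: "0 < \<eta>" "\<And>x. x \<in> \<Omega> \<Longrightarrow> q x + \<eta> \<le> critical_exponent s p x"
  shows "modular_bounded \<Omega> s p q"
proof -
  define N where "N = real DIM('a)"
  have N: "0 < N" "s * pp < N" using spp by (auto simp: N_def)
  define \<gamma> where "\<gamma> = \<eta> * (1 - s * pp / N) / 2"
  have \<gamma>: "0 < \<gamma>" using gap(1) N by (simp add: \<gamma>_def)
  define qk where "qk k x = min (q x) (diag_exponent p x + real k * \<gamma>)" for k x
  have d: "1 \<le> diag_exponent p x \<and> diag_exponent p x \<le> pp" if "x \<in> \<Omega>" for x
    using p[of "(x, x)"] that by (simp add: diag_exponent_def)
  have qk_uc: "uniformly_continuous_on \<Omega> (qk k)" for k
    unfolding uniformly_continuous_on_def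
  proof (intro allI impI)
    fix e :: real assume e: "0 < e"
    obtain \<delta>1 where \<delta>1: "0 < \<delta>1" "\<And>z z'. z \<in> \<Omega> \<times> \<Omega> \<Longrightarrow> z' \<in> \<Omega> \<times> \<Omega> \<Longrightarrow> dist z' z < \<delta>1 \<Longrightarrow> dist (p z') (p z) < e"
      using puc e unfolding uniformly_continuous_on_def by metis
    obtain \<delta>2 where \<delta>2: "0 < \<delta>2" "\<And>z z'. z \<in> \<Omega> \<Longrightarrow> z' \<in> \<Omega> \<Longrightarrow> dist z' z < \<delta>2 \<Longrightarrow> dist (q z') (q z) < e"
      using quc e unfolding uniformly_continuous_on_def by metis
    show "\<exists>\<delta>>0. \<forall>x\<in>\<Omega>. \<forall>x'\<in>\<Omega>. dist x' x < \<delta> \<longrightarrow> dist (qk k x') (qk k x) < e"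
    proof (intro exI[of _ "min (\<delta>1 / 2) \<delta>2"] conjI ballI impI)
      fix x x' assume x: "x \<in> \<Omega>" "x' \<in> \<Omega>" "dist x' x < min (\<delta>1 / 2) \<delta>2"
      have "dist (x', x') (x, x) \<le> dist x' x + dist x' x"
        unfolding dist_Pair_Pair by (rule sqrt_sum_squares_le_sum) auto
      then have "dist (p (x', x')) (p (x, x)) < e" using x by (intro \<delta>1(2)) auto
      moreover have "dist (q x') (q x) < e" using x by (intro \<delta>2(2)) auto
      ultimately show "dist (qk k x') (qk k x) < e"
        by (auto simp: qk_def diag_exponent_def dist_real_def min_def)
    qed (use \<delta>1(1) \<delta>2(1) in auto)
  qed
  have qk_bounds: "diag_exponent p x \<le> qk k x" "qk k x \<le> q x" if "x \<in> \<Omega>" for k x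
    using q[OF that] \<gamma> by (auto simp: qk_def)
  have qk_bdd: "modular_bounded \<Omega> s p (qk k)" for k
  proof (induction k)
    case 0
    have "(\<integral>\<^sup>+ x. ennreal (\<bar>v x\<bar> powr qk 0 x) \<partial>lebesgue_on \<Omega>) =
        (\<integral>\<^sup>+ x. ennreal (\<bar>v x\<bar> powr diag_exponent p x) \<partial>lebesgue_on \<Omega>)" for v
      using q by (intro nn_integral_cong) (auto simp: qk_def min_def dest: antisym)
    then show ?case unfolding modular_bounded_def
      by (intro exI[of _ 1]) (auto simp: unit_modular_class_def)
  next
    case (Suc k)
    show ?case
    proof (rule modular_bounded_step[OF dens \<Omega> s puc p qk_uc[of k] _ _ \<gamma> _ Suc, where qq = qq])
      show "qk (Suc k) \<in> borel_measurable (lebesgue_on \<Omega>)"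
        by (intro continuous_imp_measurable_on_sets_lebesgue \<Omega> uniformly_continuous_imp_continuous qk_uc)
      fix x assume x: "x \<in> \<Omega>"
      show "1 \<le> qk k x \<and> qk k x \<le> qq" using qk_bounds[OF x, of k] q[OF x] d[OF x] by auto
      define b where "b = diag_exponent p x"
      have b: "1 \<le> b" "b \<le> pp" using d[OF x] by (auto simp: b_def)
      have sb: "s * b \<le> s * pp" using b s by (intro mult_left_mono) auto
      have pos: "0 < 1 - s * b / N" using sb N by simp
      have crit: "critical_exponent s p x = b / (1 - s * b / N)"
      proof -
        have "N - s * b = N * (1 - s * b / N)" using N by (simp add: field_simps)
        then show ?thesis using N by (simp add: critical_exponent_def flip: b_def N_def)
      qed
      have "2 * \<gamma> \<le> \<eta> * (1 - s * b / N)"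
        unfolding \<gamma>_def using gap(1) sb N
        by (simp add: mult_left_mono divide_right_mono)
      also have "\<dots> \<le> (b / (1 - s * b / N) - qk k x) * (1 - s * b / N)"
        using gap(2)[OF x] qk_bounds[OF x, of k] pos crit by (intro mult_right_mono) auto
      also have "\<dots> = b - qk k x * (1 - s * b / N)"
        using sb N by (auto simp: left_diff_distrib)
      also have "\<dots> = b * (1 + s * qk k x / N) - qk k x" by (simp add: algebra_simps)
      finally have "qk k x + 2 * \<gamma> \<le> b * (1 + s * qk k x / N)" by simp
      moreover have "qk (Suc k) x \<le> qk k x + \<gamma>" using \<gamma> by (auto simp: qk_def min_def algebra_simps)
      ultimately show "diag_exponent p x \<le> qk (Suc k) x \<and>
          qk (Suc k) x + \<gamma> \<le> diag_exponent p x * (1 + s * qk k x / DIM('a))"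
        using qk_bounds[OF x, of "Suc k"] by (simp add: b_def N_def)
    qed
  qed
  obtain k where k: "qq < real k * \<gamma>" using \<gamma> reals_Archimedean3 by blast
  have "qk k x = q x" if "x \<in> \<Omega>" for x
    using k q[OF that] d[OF that] by (auto simp: qk_def)
  then have "(\<integral>\<^sup>+ x. ennreal (\<bar>v x\<bar> powr qk k x) \<partial>lebesgue_on \<Omega>) =
        (\<integral>\<^sup>+ x. ennreal (\<bar>v x\<bar> powr q x) \<partial>lebesgue_on \<Omega>)" for v
    by (intro nn_integral_cong) auto
  then show ?thesis using qk_bdd[of k] by (simp add: modular_bounded_def)
qed

section \<open>From modulars to norms\<close>

lemma powr_divide_le:
  fixes t l a :: real
  assumes "1 \<le> l" "1 \<le> a" "0 \<le> t"
  shows "(t / l) powr a \<le> 1 / l * t powr a"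
proof -
  have "l powr 1 \<le> l powr a" using assms by (intro powr_mono) auto
  then have "t powr a / l powr a \<le> t powr a / l" using assms by (intro divide_left_mono) auto
  then show ?thesis using assms by (simp add: powr_divide)
qed

lemma lebesgue_modular_scale:
  assumes "\<And>x. x \<in> \<Omega> \<Longrightarrow> 1 \<le> q x" "1 \<le> l"
  shows "(\<integral>\<^sup>+ x. ennreal (\<bar>u x / l\<bar> powr q x) \<partial>lebesgue_on \<Omega>) \<le>
    ennreal (1 / l) * (\<integral>\<^sup>+ x. ennreal (\<bar>u x\<bar> powr q x) \<partial>lebesgue_on \<Omega>)"
proof -
  have "(\<integral>\<^sup>+ x. ennreal (\<bar>u x / l\<bar> powr q x) \<partial>lebesgue_on \<Omega>) \<le>
      (\<integral>\<^sup>+ x. ennreal (1 / l) * ennreal (\<bar>u x\<bar> powr q x) \<partial>lebesgue_on \<Omega>)"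
    using assms powr_divide_le[of l "q _" "\<bar>u _\<bar>"]
    by (intro nn_integral_mono) (simp add: abs_divide flip: ennreal_mult)
  also have "\<dots> \<le> ennreal (1 / l) * (\<integral>\<^sup>+ x. ennreal (\<bar>u x\<bar> powr q x) \<partial>lebesgue_on \<Omega>)"
    using assms(2) by (intro nn_integral_cmult_le) auto
  finally show ?thesis .
qed

lemma gagliardo_modular_eq:
  assumes "0 < t"
  shows "gagliardo_modular \<Omega> s p u t =
    (\<integral>\<^sup>+ y. gagliardo_slice \<Omega> s p (\<lambda>x. u x / t) y \<partial>lebesgue_on \<Omega>)"
proof -
  have "\<bar>u x / t - u y / t\<bar> powr e / d = \<bar>u x - u y\<bar> powr e / (t powr e * d)" for x y e d
  proof -
    have "\<bar>u x / t - u y / t\<bar> = \<bar>u x - u y\<bar> / t"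
      using assms by (simp flip: diff_divide_distrib)
    then show ?thesis using assms by (simp add: powr_divide)
  qed
  then show ?thesis by (simp add: gagliardo_modular_def gagliardo_slice_def)
qed

lemma gagliardo_slice_scale:
  fixes \<Omega> :: "'a::euclidean_space set"
  assumes "\<And>x. x \<in> \<Omega> \<Longrightarrow> 1 \<le> p (x, y)" "1 \<le> l"
  shows "gagliardo_slice \<Omega> s p (\<lambda>x. v x / l) y \<le> ennreal (1 / l) * gagliardo_slice \<Omega> s p v y"
proof -
  have *: "\<bar>v x / l - v y / l\<bar> powr p (x, y) / d \<le> 1 / l * (\<bar>v x - v y\<bar> powr p (x, y) / d)"
    if "x \<in> \<Omega>" "0 \<le> d" for x d
  proof -
    have "\<bar>v x / l - v y / l\<bar> = \<bar>v x - v y\<bar> / l"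
      using assms(2) by (simp flip: diff_divide_distrib)
    then have "\<bar>v x / l - v y / l\<bar> powr p (x, y) \<le> 1 / l * \<bar>v x - v y\<bar> powr p (x, y)"
      using powr_divide_le[OF assms(2) assms(1)[OF that(1)], of "\<bar>v x - v y\<bar>"] by simp
    from divide_right_mono[OF this that(2)] show ?thesis by simp
  qed
  have "gagliardo_slice \<Omega> s p (\<lambda>x. v x / l) y \<le> (\<integral>\<^sup>+ x. ennreal (1 / l) *
      ennreal (\<bar>v x - v y\<bar> powr p (x, y) / norm (x - y) powr (real DIM('a) + s * p (x, y)))
      \<partial>lebesgue_on \<Omega>)"
    unfolding gagliardo_slice_def using assms(2)
    by (intro nn_integral_mono) (subst ennreal_mult[symmetric], simp, simp, intro ennreal_leI *, auto)
  also have "\<dots> \<le> ennreal (1 / l) * gagliardo_slice \<Omega> s p v y"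
    unfolding gagliardo_slice_def using assms(2) by (intro nn_integral_cmult_le) auto
  finally show ?thesis .
qed

lemma gagliardo_modular_scale:
  assumes p: "\<And>z. z \<in> \<Omega> \<times> \<Omega> \<Longrightarrow> 1 \<le> p z" and "1 \<le> l" "0 < t"
  shows "gagliardo_modular \<Omega> s p u (t * l) \<le> ennreal (1 / l) * gagliardo_modular \<Omega> s p u t"
proof -
  have "gagliardo_modular \<Omega> s p u (t * l) \<le>
      (\<integral>\<^sup>+ y. ennreal (1 / l) * gagliardo_slice \<Omega> s p (\<lambda>x. u x / t) y \<partial>lebesgue_on \<Omega>)"
    unfolding gagliardo_modular_eq[OF mult_pos_pos[OF \<open>0 < t\<close> less_le_trans[OF zero_less_one \<open>1 \<le> l\<close>]]]
    using gagliardo_slice_scale[OF _ \<open>1 \<le> l\<close>, of \<Omega> p _ s "\<lambda>x. u x / t"] p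
    by (intro nn_integral_mono) simp
  also have "\<dots> \<le> ennreal (1 / l) * gagliardo_modular \<Omega> s p u t"
    unfolding gagliardo_modular_eq[OF \<open>0 < t\<close>] using assms(2) by (intro nn_integral_cmult_le) auto
  finally show ?thesis .
qed

lemma ennreal_shrink:
  assumes "X < (\<infinity>::ennreal)"
  obtains l :: real where "1 \<le> l" "ennreal (1 / l) * X < 1"
proof -
  obtain a where a: "0 \<le> a" "X = ennreal a" using assms by (cases X) auto
  have "ennreal (1 / (a + 1)) * X < 1"
    using a by (simp add: ennreal_less_iff flip: ennreal_mult ennreal_1)
  then show thesis using that[of "a + 1"] a by simp
qed

text \<open>
  Both norms are infima of sets of admissible dilation factors.  These sets are closed under
  enlarging the factor, and finiteness of the modulars makes them nonempty, so any \<open>t\<close> above the sum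
  of the infima lies in both.  Taking \<open>t\<close> strictly larger than the norm also covers
  functions of norm \<open>0\<close>.
\<close>

lemma normalized_in_unit_modular_class:
  assumes p: "\<And>z. z \<in> \<Omega> \<times> \<Omega> \<Longrightarrow> 1 \<le> p z"
    and u: "u \<in> sobolev_var \<Omega> s p" and t: "sobolev_norm \<Omega> s p u < t"
  shows "0 < t" "(\<lambda>x. u x / t) \<in> unit_modular_class \<Omega> s p"
proof -
  let ?I = "\<lambda>t. \<integral>\<^sup>+ x. ennreal (\<bar>u x / t\<bar> powr diag_exponent p x) \<partial>lebesgue_on \<Omega>"
  define S1 where "S1 = {t. 0 < t \<and> ?I t \<le> 1}"
  define S2 where "S2 = {t. 0 < t \<and> gagliardo_modular \<Omega> s p u t < 1}"
  have d: "1 \<le> diag_exponent p x" if "x \<in> \<Omega>" for x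
    using p[of "(x, x)"] that by (simp add: diag_exponent_def)
  have um: "u \<in> borel_measurable (lebesgue_on \<Omega>)"
    using u by (simp add: sobolev_var_def lebesgue_var_def)
  have "?I 1 < \<infinity>" using u by (simp add: sobolev_var_def lebesgue_var_def)
  then obtain l where l: "1 \<le> l" "ennreal (1 / l) * ?I 1 < 1" by (rule ennreal_shrink)
  have "?I l \<le> ennreal (1 / l) * ?I 1"
    using lebesgue_modular_scale[OF d l(1), where u = u] by simp
  with l have S1: "l \<in> S1" by (auto simp: S1_def)
  obtain t0 where t0: "0 < t0" "gagliardo_modular \<Omega> s p u t0 < \<infinity>"
    using u by (auto simp: sobolev_var_def)
  obtain k where k: "1 \<le> k" "ennreal (1 / k) * gagliardo_modular \<Omega> s p u t0 < 1"
    using ennreal_shrink[OF t0(2)] by blast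
  have gag: "gagliardo_modular \<Omega> s p u (t * l) \<le> ennreal (1 / l) * gagliardo_modular \<Omega> s p u t"
    if "1 \<le> l" "0 < t" for l t
    using p that by (rule gagliardo_modular_scale)
  have S2: "t0 * k \<in> S2"
    using gag[OF k(1) t0(1)] k t0 by (auto simp: S2_def)
  have norm: "sobolev_norm \<Omega> s p u = Inf S1 + Inf S2"
    by (simp add: sobolev_norm_def luxemburg_norm_def gagliardo_seminorm_def S1_def S2_def)
  have "0 \<le> Inf S1" "0 \<le> Inf S2"
    using S1 S2 by (auto intro!: cInf_greatest simp: S1_def S2_def)
  then have "Inf S1 < t" "Inf S2 < t" using t norm by linarith+
  moreover have "S1 \<noteq> {}" "S2 \<noteq> {}" using S1 S2 by auto
  ultimately obtain t1 t2 where t12: "t1 \<in> S1" "t1 < t" "t2 \<in> S2" "t2 < t"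
    using cInf_lessD[of S1 t] cInf_lessD[of S2 t] by blast
  show "0 < t" using t12 by (auto simp: S1_def)
  have "?I t \<le> ennreal (1 / (t / t1)) * ?I t1"
    using lebesgue_modular_scale[OF d, where l = "t / t1" and u = "\<lambda>x. u x / t1"] t12
    by (simp add: S1_def)
  also have "\<dots> \<le> 1 * 1"
    using t12 by (intro mult_mono) (auto simp: S1_def)
  finally have 1: "?I t \<le> 1" by simp
  have "gagliardo_modular \<Omega> s p u t \<le> ennreal (1 / (t / t2)) * gagliardo_modular \<Omega> s p u t2"
    using gag[of "t / t2" t2] t12 by (simp add: S2_def)
  also have "\<dots> \<le> 1 * 1"
    using t12 by (intro mult_mono) (auto simp: S2_def)
  finally have 2: "gagliardo_modular \<Omega> s p u t \<le> 1" by simp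
  show "(\<lambda>x. u x / t) \<in> unit_modular_class \<Omega> s p"
    using 1 2 um \<open>0 < t\<close> by (simp add: unit_modular_class_def gagliardo_modular_eq)
qed

text \<open>
  If \<open>t\<close> exceeds the Sobolev norm of \<open>u\<close>, then \<open>u / t\<close> has \<open>q\<close>-modular at most \<open>C\<close>, hence
  \<open>u / (t C)\<close> has \<open>q\<close>-modular at most \<open>1\<close>; let \<open>t\<close> decrease to the norm.
\<close>

lemma embedding_of_modular_bounded:
  assumes p: "\<And>z. z \<in> \<Omega> \<times> \<Omega> \<Longrightarrow> 1 \<le> p z"
    and q: "\<And>x. x \<in> \<Omega> \<Longrightarrow> 1 \<le> q x \<and> q x \<le> qq"
    and bnd: "modular_bounded \<Omega> s p q"
  shows "sobolev_var \<Omega> s p \<subseteq> lebesgue_var \<Omega> q \<and>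
    (\<exists>C>0. \<forall>u \<in> sobolev_var \<Omega> s p. luxemburg_norm \<Omega> q u \<le> C * sobolev_norm \<Omega> s p u)"
proof -
  obtain C0 where C0: "0 \<le> C0" "\<And>v. v \<in> unit_modular_class \<Omega> s p \<Longrightarrow>
      (\<integral>\<^sup>+ x. ennreal (\<bar>v x\<bar> powr q x) \<partial>lebesgue_on \<Omega>) \<le> ennreal C0"
    using bnd unfolding modular_bounded_def by blast
  define C where "C = max 1 C0"
  have C: "1 \<le> C" by (simp add: C_def)
  have Cb: "(\<integral>\<^sup>+ x. ennreal (\<bar>v x\<bar> powr q x) \<partial>lebesgue_on \<Omega>) \<le> ennreal C"
    if "v \<in> unit_modular_class \<Omega> s p" for v
    using C0(2)[OF that] by (rule order_trans) (simp add: C_def ennreal_leI)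
  have "u \<in> lebesgue_var \<Omega> q" if u: "u \<in> sobolev_var \<Omega> s p" for u
  proof -
    define t where "t = max 1 (sobolev_norm \<Omega> s p u + 1)"
    have t: "1 \<le> t" "sobolev_norm \<Omega> s p u < t" by (auto simp: t_def)
    note n = normalized_in_unit_modular_class[OF p u t(2)]
    have "(\<integral>\<^sup>+ x. ennreal (\<bar>u x\<bar> powr q x) \<partial>lebesgue_on \<Omega>) \<le>
      (\<integral>\<^sup>+ x. ennreal (t powr qq) * ennreal (\<bar>u x / t\<bar> powr q x) \<partial>lebesgue_on \<Omega>)"
    proof (intro nn_integral_mono)
      fix x assume "x \<in> space (lebesgue_on \<Omega>)"
      then have x: "x \<in> \<Omega>" by simp
      have "\<bar>u x\<bar> powr q x = t powr q x * \<bar>u x / t\<bar> powr q x"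
        using t(1) by (simp add: powr_divide)
      also have "\<dots> \<le> t powr qq * \<bar>u x / t\<bar> powr q x"
        using q[OF x] t(1) by (intro mult_right_mono powr_mono) auto
      finally show "ennreal (\<bar>u x\<bar> powr q x) \<le> ennreal (t powr qq) * ennreal (\<bar>u x / t\<bar> powr q x)"
        by (simp flip: ennreal_mult)
    qed
    also have "\<dots> \<le> ennreal (t powr qq) * (\<integral>\<^sup>+ x. ennreal (\<bar>u x / t\<bar> powr q x) \<partial>lebesgue_on \<Omega>)"
      using t(1) by (intro nn_integral_cmult_le) auto
    also have "\<dots> \<le> ennreal (t powr qq) * ennreal C"
      using Cb[OF n(2)] by (intro mult_left_mono) auto
    also have "\<dots> < \<infinity>" by (simp add: ennreal_mult_less_top)
    finally show ?thesis using u by (simp add: sobolev_var_def lebesgue_var_def)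
  qed
  moreover have "luxemburg_norm \<Omega> q u \<le> C * sobolev_norm \<Omega> s p u"
    if u: "u \<in> sobolev_var \<Omega> s p" for u
  proof -
    have "luxemburg_norm \<Omega> q u / C \<le> t" if t: "sobolev_norm \<Omega> s p u < t" for t
    proof -
      note n = normalized_in_unit_modular_class[OF p u t]
      have "(\<integral>\<^sup>+ x. ennreal (\<bar>u x / (t * C)\<bar> powr q x) \<partial>lebesgue_on \<Omega>) \<le>
        ennreal (1 / C) * (\<integral>\<^sup>+ x. ennreal (\<bar>u x / t\<bar> powr q x) \<partial>lebesgue_on \<Omega>)"
        using lebesgue_modular_scale[of \<Omega> q C "\<lambda>x. u x / t"] q C by simp
      also have "\<dots> \<le> ennreal (1 / C) * ennreal C"
        using Cb[OF n(2)] by (intro mult_left_mono) auto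
      also have "\<dots> = 1" using C by (simp flip: ennreal_mult)
      finally have "luxemburg_norm \<Omega> q u \<le> t * C"
        unfolding luxemburg_norm_def using n(1) C
        by (intro cInf_lower bdd_belowI[of _ 0]) auto
      then show ?thesis using C by (simp add: field_simps)
    qed
    then have "luxemburg_norm \<Omega> q u / C \<le> sobolev_norm \<Omega> s p u" by (rule dense_ge)
    then show ?thesis using C by (simp add: field_simps)
  qed
  moreover have "0 < C" using C by simp
  ultimately show ?thesis by blast
qed

section \<open>The embedding theorem\<close>

theorem theorem1p1:
  fixes \<Omega> :: "'a::euclidean_space set"
    and s :: real
    and p :: "'a \<times> 'a \<Rightarrow> real"
    and q :: "'a \<Rightarrow> real"
  assumes "open \<Omega>" and "connected \<Omega>" and "\<not> bounded \<Omega>"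
    and "cone_condition \<Omega>"
    and "0 < s" and "s < 1"
    and "\<forall>z \<in> closure \<Omega> \<times> closure \<Omega>. 1 < p z"
    and "uniformly_continuous_on (closure \<Omega> \<times> closure \<Omega>) p"
    and "1 < (INF z \<in> closure \<Omega> \<times> closure \<Omega>. p z)"
    and "bdd_above (p ` (closure \<Omega> \<times> closure \<Omega>))"
    and "\<forall>x \<in> closure \<Omega>. \<forall>y \<in> closure \<Omega>. p (x, y) = p (y, x)"
    and "s * (SUP z \<in> closure \<Omega> \<times> closure \<Omega>. p z) < real DIM('a)"
    and "\<forall>x \<in> closure \<Omega>. 1 < q x"
    and "uniformly_continuous_on (closure \<Omega>) q"
    and "\<forall>x \<in> closure \<Omega>. diag_exponent p x \<le> q x"
    and "bdd_below ((\<lambda>x. critical_exponent s p x - q x) ` closure \<Omega>)"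
    and "0 < (INF x \<in> closure \<Omega>. critical_exponent s p x - q x)"
  shows "sobolev_var \<Omega> s p \<subseteq> lebesgue_var \<Omega> q \<and>
    (\<exists>C>0. \<forall>u \<in> sobolev_var \<Omega> s p. luxemburg_norm \<Omega> q u \<le> C * sobolev_norm \<Omega> s p u)"
proof -
  define pp where "pp = (SUP z \<in> closure \<Omega> \<times> closure \<Omega>. p z)"
  define \<eta> where "\<eta> = (INF x \<in> closure \<Omega>. critical_exponent s p x - q x)"
  have sub: "\<Omega> \<subseteq> closure \<Omega>" by (rule closure_subset)
  have p: "1 \<le> p z \<and> p z \<le> pp" if "z \<in> \<Omega> \<times> \<Omega>" for z
  proof -
    have "z \<in> closure \<Omega> \<times> closure \<Omega>" using that sub by blast
    then show ?thesis unfolding pp_def using assms(7,10) by (auto intro: cSUP_upper less_imp_le)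
  qed
  have gap: "q x + \<eta> \<le> critical_exponent s p x" if "x \<in> \<Omega>" for x
  proof -
    have "\<eta> \<le> critical_exponent s p x - q x"
      unfolding \<eta>_def using assms(16) that sub by (intro cINF_lower) auto
    then show ?thesis by simp
  qed
  have \<eta>: "0 < \<eta>" and spp: "s * pp < DIM('a)" using assms(12,17) by (auto simp: \<eta>_def pp_def)
  define qq where "qq = DIM('a) * pp / (DIM('a) - s * pp)"
  have q: "1 \<le> q x" "diag_exponent p x \<le> q x \<and> q x \<le> qq" if x: "x \<in> \<Omega>" for x
  proof -
    have d: "1 \<le> diag_exponent p x" "diag_exponent p x \<le> pp"
      using p[of "(x, x)"] x by (auto simp: diag_exponent_def)
    have "critical_exponent s p x \<le> qq"
      unfolding critical_exponent_def qq_def using d spp \<open>0 < s\<close>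
      by (intro frac_le mult_left_mono diff_left_mono) auto
    then show "diag_exponent p x \<le> q x \<and> q x \<le> qq"
      using gap[OF x] \<eta> assms(15) x sub by auto
    show "1 \<le> q x" using assms(13) x sub by (auto intro: less_imp_le)
  qed
  have \<Omega>: "\<Omega> \<in> sets lebesgue" using \<open>open \<Omega>\<close> by auto
  obtain c R where dens: "measure_density \<Omega> c R"
    using cone_condition_measure_density[OF \<open>cone_condition \<Omega>\<close> \<Omega>] .
  have puc: "uniformly_continuous_on (\<Omega> \<times> \<Omega>) p"
    using assms(8) Sigma_mono[OF sub sub] unfolding uniformly_continuous_on_def by (meson subsetD)
  have quc: "uniformly_continuous_on \<Omega> q"
    using assms(14) sub unfolding uniformly_continuous_on_def by (meson subsetD)
  have "modular_bounded \<Omega> s p q"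
    using modular_bounded_subcritical[OF dens \<Omega> \<open>0 < s\<close> puc p spp quc q(2) \<eta> gap] by blast
  then show ?thesis
    using p q by (intro embedding_of_modular_bounded[where qq = qq]) auto
qed

end
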